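(* Let $n\in\mathbb{N}$, $n\ge 1$, and let $\delta>0$. Suppose that real numbers $p_{ij}>0$, for $i\in\{1,2\}$ and $j\in\{1,\dots,n\}$, fulfill $\sum_{i=1}^{2}\sum_{j=1}^{n}p_{ij}\neq 3n$. Let $V$ be a normed space and let $W$ be a Banach space. If $f:V^n\to W$ is a mapping satisfying the inequality $$\|\mathfrak Df(x_1,x_2)\|\le\delta\prod_{i=1}^{2}\prod_{j=1}^{n}\|x_{ij}\|^{p_{ij}}$$ for all $x_1=(x_{11},\dots,x_{1n}),\,x_2=(x_{21},\dots,x_{2n})\in V^n$, where $$\mathfrak Df(x_1,x_2):=\sum_{q\in\{-1,1\}^n} f(2x_1+qx_2)-\sum_{k=0}^{n}2^{n-k}12^{k}f(\mathcal M_{k}^n)$$ and $f(\mathcal M_k^n)=\sum_{s} f(x_1+sx_2)$, the sum being over all $s\in\{-1,0,1\}^n$ having exactly $k$ entries equal to $0$, then $f$ is multi-cubic.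
   Context: For $x_i=(x_{i1},\dots,x_{in})\in V^n$ ($i\in\{1,2\}$) and $t=(t_1,\dots,t_n)\in\{-1,0,1\}^n$, write $2x_1=(2x_{11},\dots,2x_{1n})$ and $tx_2=(t_1x_{21},\dots,t_nx_{2n})$; addition in $V^n$ is componentwise. A mapping $\mathfrak C:V\to W$ is called cubic if $\mathfrak C(2x+y)+\mathfrak C(2x-y)=2\mathfrak C(x+y)+2\mathfrak C(x-y)+12\mathfrak C(x)$ for all $x,y\in V$. A mapping $f:V^n\to W$ is called multi-cubic if it is cubic in each variable, i.e. for each $j\in\{1,\dots,n\}$ and each choice of the other $n-1$ arguments, the resulting mapping of the $j$th argument is cubic. The quantity $f(\mathcal M_k^n)$ (depending on $x_1,x_2$) is the sum of $f(N_1,\dots,N_n)$ over all choices of $N_j\in\{x_{1j}+x_{2j},\,x_{1j}-x_{2j},\,x_{1j}\}$ in which exactly $k$ of the components are chosen to be $x_{1j}$. *)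

theory Defs
  imports "HOL-Analysis.Analysis"
begin

definition cubic :: "('a::real_vector \<Rightarrow> 'b::real_vector) \<Rightarrow> bool" where
  "cubic C \<longleftrightarrow> (\<forall>x y. C (2 *\<^sub>R x + y) + C (2 *\<^sub>R x - y)
      = 2 *\<^sub>R C (x + y) + 2 *\<^sub>R C (x - y) + 12 *\<^sub>R C x)"

definition multi_cubic :: "('a::real_vector ^ 'n \<Rightarrow> 'b::real_vector) \<Rightarrow> bool" where
  "multi_cubic f \<longleftrightarrow> (\<forall>j x. cubic (\<lambda>v. f (\<chi> i. if i = j then v else x $ i)))"

definition sign_scale :: "real ^ 'n \<Rightarrow> 'a::real_vector ^ 'n \<Rightarrow> 'a ^ 'n" where
  "sign_scale t x = (\<chi> j. t $ j *\<^sub>R x $ j)"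

definition full_signs :: "(real ^ 'n) set" where
  "full_signs = {q. \<forall>j. q $ j \<in> {-1, 1}}"

text \<open>The entry \<open>s $ j = 0\<close> corresponds to choosing the bare first argument \<open>x\<^sub>1 $ j\<close>
  in component \<open>j\<close>.\<close>

definition zero_signs :: "nat \<Rightarrow> (real ^ 'n) set" where
  "zero_signs k = {s. (\<forall>j. s $ j \<in> {-1, 0, 1}) \<and> card {j. s $ j = 0} = k}"

text \<open>Finiteness of the index sets guarantees that the sums over them below do not collapse
  to \<open>0\<close> by convention.\<close>

lemma finite_vec_entries:
  fixes A :: "'a set"
  assumes "finite A"
  shows "finite {t :: 'a ^ 'n. \<forall>j. t $ j \<in> A}"
proof (rule finite_subset)
  show "{t :: 'a ^ 'n. \<forall>j. t $ j \<in> A} \<subseteq> vec_lambda ` (PiE UNIV (\<lambda>_. A))"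
  proof
    fix t :: "'a ^ 'n"
    assume "t \<in> {t. \<forall>j. t $ j \<in> A}"
    then have "vec_nth t \<in> PiE UNIV (\<lambda>_. A)" by auto
    then show "t \<in> vec_lambda ` (PiE UNIV (\<lambda>_. A))"
      by (metis image_eqI vec_nth_inverse)
  qed
  show "finite (vec_lambda ` (PiE (UNIV :: 'n set) (\<lambda>_. A)))"
    using assms by (intro finite_imageI finite_PiE) auto
qed

lemma finite_full_signs: "finite (full_signs :: (real ^ 'n) set)"
  unfolding full_signs_def by (rule finite_vec_entries) simp

lemma finite_zero_signs: "finite (zero_signs k :: (real ^ 'n) set)"
  unfolding zero_signs_def
  by (rule finite_subset[OF _ finite_vec_entries[of "{-1, 0, 1}"]]) auto

definition M_sum :: "('a::real_vector ^ 'n \<Rightarrow> 'b::real_vector) \<Rightarrow> nat \<Rightarrow> 'a ^ 'n \<Rightarrow> 'a ^ 'n \<Rightarrow> 'b" where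
  "M_sum f k x\<^sub>1 x\<^sub>2 = (\<Sum>s\<in>zero_signs k. f (x\<^sub>1 + sign_scale s x\<^sub>2))"

definition D_op :: "('a::real_vector ^ 'n \<Rightarrow> 'b::real_vector) \<Rightarrow> 'a ^ 'n \<Rightarrow> 'a ^ 'n \<Rightarrow> 'b" where
  "D_op f x\<^sub>1 x\<^sub>2 = (\<Sum>q\<in>full_signs. f (2 *\<^sub>R x\<^sub>1 + sign_scale q x\<^sub>2))
      - (\<Sum>k=0..CARD('n). (2 ^ (CARD('n) - k) * 12 ^ k) *\<^sub>R M_sum f k x\<^sub>1 x\<^sub>2)"

end

theory Submission
  imports Defs
begin

text \<open>Putting \<open>x\<^sub>2 = 0\<close> gives \<open>f (2 x) = 8^n f x\<close>, so both sides of the hypothesis are homogeneous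
  under doubling, with different factors, whence \<open>\<DD> f = 0\<close>. Taking \<open>x\<^sub>2\<close> supported on one
  coordinate then shows that the fourth differences of \<open>f\<close> in each variable vanish, so the operator
  \<open>T\<^sub>j\<close> of doubling the \<open>j\<close>th variable is annihilated by \<open>(T - 1) (T - 2) (T - 4) (T - 8)\<close>.
  The \<open>T\<^sub>j\<close> commute and their product acts on \<open>f\<close> as \<open>8^n\<close>; since all their eigenvalues are at most
  \<open>8\<close>, this forces \<open>T\<^sub>j f = 8 f\<close>, which turns the vanishing fourth difference into the cubic equation.\<close>

section \<open>Commuting doubling operators\<close>

definition dbl :: "'n set \<Rightarrow> 'a::real_vector ^ 'n \<Rightarrow> 'a ^ 'n" where
  "dbl S x = (\<chi> i. (if i \<in> S then 2 else 1) *\<^sub>R x $ i)"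

definition dbl_diff :: "real \<Rightarrow> 'n \<Rightarrow> ('a::real_vector ^ 'n \<Rightarrow> 'b::real_vector) \<Rightarrow> 'a ^ 'n \<Rightarrow> 'b" where
  "dbl_diff c j h = (\<lambda>x. h (dbl {j} x) - c *\<^sub>R h x)"

text \<open>The roots 1, 2, 4, 8 are the factors \<open>2 ^ d\<close> by which doubling acts on
  monomials of degree d at most 3 in the \<open>j\<close>th variable.\<close>

definition dbl_quartic :: "'n \<Rightarrow> ('a::real_vector ^ 'n \<Rightarrow> 'b::real_vector) \<Rightarrow> 'a ^ 'n \<Rightarrow> 'b" where
  "dbl_quartic j h = dbl_diff 1 j (dbl_diff 2 j (dbl_diff 4 j (dbl_diff 8 j h)))"

lemma dbl_commute: "dbl S (dbl T x) = dbl T (dbl S x)"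
  by (simp add: dbl_def vec_eq_iff mult.commute)

lemma dbl_insert: "j \<notin> S \<Longrightarrow> dbl (insert j S) x = dbl {j} (dbl S x)"
  by (auto simp: dbl_def vec_eq_iff)

lemma dbl_empty [simp]: "dbl {} x = x"
  by (simp add: dbl_def vec_eq_iff)

lemma dbl_UNIV: "dbl UNIV x = 2 *\<^sub>R x"
  by (simp add: dbl_def vec_eq_iff)

lemma dbl_diff_commute: "dbl_diff c i (dbl_diff d j h) = dbl_diff d j (dbl_diff c i h)"
  by (rule ext) (simp add: dbl_diff_def dbl_commute[of "{i}" "{j}"] algebra_simps)

lemma dbl_diff_4:
  "dbl_diff a j (dbl_diff b j (dbl_diff c j (dbl_diff d j h))) x
    = h (dbl {j} (dbl {j} (dbl {j} (dbl {j} x)))) - (a + b + c + d) *\<^sub>R h (dbl {j} (dbl {j} (dbl {j} x)))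
      + (a * b + a * c + a * d + b * c + b * d + c * d) *\<^sub>R h (dbl {j} (dbl {j} x))
      - (a * b * c + a * b * d + a * c * d + b * c * d) *\<^sub>R h (dbl {j} x) + (a * b * c * d) *\<^sub>R h x"
  by (simp add: dbl_diff_def algebra_simps)

lemma dbl_diff_zero [simp]: "dbl_diff c j (\<lambda>x. 0) = (\<lambda>x. 0)"
  by (simp add: dbl_diff_def)

lemma dbl_diff_eq_zero:
  "dbl_diff c i h = (\<lambda>x. 0) \<Longrightarrow> dbl_diff c i (dbl_diff d j h) = (\<lambda>x. 0)"
  by (simp add: dbl_diff_commute[of c i])

lemma dbl_quartic_eq_zero:
  assumes "dbl_quartic i h = (\<lambda>x. 0)"
  shows "dbl_quartic i (dbl_diff d j h) = (\<lambda>x. 0)"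
proof -
  have "dbl_quartic i (dbl_diff d j h) = dbl_diff d j (dbl_quartic i h)"
    unfolding dbl_quartic_def by (simp only: dbl_diff_commute[of _ i d j])
  then show ?thesis using assms by simp
qed

lemma dbl_diff_homogeneous:
  assumes "\<And>x. h (2 *\<^sub>R x) = l *\<^sub>R h x"
  shows "dbl_diff c j h (2 *\<^sub>R x) = l *\<^sub>R dbl_diff c j h x"
proof -
  have "dbl {j} (2 *\<^sub>R x) = 2 *\<^sub>R dbl {j} x"
    using dbl_commute[of "{j}" UNIV x] by (simp only: dbl_UNIV)
  then show ?thesis
    by (simp add: dbl_diff_def assms scaleR_diff_right mult.commute)
qed

section \<open>Joint eigenfunctions of the doubling operators\<close>

lemma eigenfunction_dbl:
  fixes S :: "'n::finite set"
  assumes "\<And>j. j \<in> S \<Longrightarrow> dbl_diff (a j) j h = (\<lambda>x. 0)"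
  shows "h (dbl S x) = (\<Prod>j\<in>S. a j) *\<^sub>R h x"
  using finite[of S] assms
proof (induction S)
  case (insert j S)
  have "h (dbl {j} (dbl S x)) = a j *\<^sub>R h (dbl S x)"
    using fun_cong[OF insert.prems[of j], of "dbl S x"] by (simp add: dbl_diff_def)
  moreover have "h (dbl S x) = (\<Prod>j\<in>S. a j) *\<^sub>R h x"
    using insert.prems by (intro insert.IH) auto
  ultimately show ?case
    using insert.hyps by (simp add: dbl_insert[OF insert.hyps(2)])
qed simp

text \<open>\<open>S\<close> collects the coordinates not yet diagonalised. Once it is empty,
  \<open>h\<close> is a joint eigenfunction, so \<open>h (2 *\<^sub>R x)\<close> equals the product
  of the \<open>a i\<close> times \<open>h x\<close>. As \<open>a k\<close> is at most 4, that
  product is at most \<open>4 * 8 ^ (n - 1)\<close>, below the prescribed factor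
  \<open>8 ^ n\<close>, so \<open>h\<close> vanishes.\<close>

lemma dbl_eigenfunction_zero:
  fixes h :: "'a::real_vector ^ 'n::finite \<Rightarrow> 'b::real_vector" and a :: "'n \<Rightarrow> real"
  assumes "\<And>j. j \<in> S \<Longrightarrow> dbl_quartic j h = (\<lambda>x. 0)"
    and "\<And>i. i \<notin> S \<Longrightarrow> dbl_diff (a i) i h = (\<lambda>x. 0)"
    and "\<And>i. i \<notin> S \<Longrightarrow> 0 \<le> a i \<and> a i \<le> 8"
    and "k \<notin> S" "a k \<le> 4"
    and "\<And>x. h (2 *\<^sub>R x) = (8 ^ CARD('n)) *\<^sub>R h x"
  shows "h = (\<lambda>x. 0)"
  using finite[of S] assms
proof (induction S arbitrary: h a)
  case empty
  have "(\<Prod>j\<in>UNIV. a j) = a k * (\<Prod>j\<in>UNIV - {k}. a j)"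
    by (simp add: prod.remove)
  also have "\<dots> \<le> 4 * (\<Prod>j\<in>UNIV - {k}. 8)"
    using empty by (intro mult_mono prod_mono prod_nonneg) auto
  also have "\<dots> < 8 * (\<Prod>j\<in>UNIV - {k}. 8::real)"
    by simp
  also have "\<dots> = (\<Prod>j\<in>(UNIV::'n set). 8::real)"
    by (rule prod.remove[symmetric]) auto
  also have "\<dots> = 8 ^ CARD('n)" by simp
  finally have ne: "(\<Prod>j\<in>UNIV. a j) \<noteq> 8 ^ CARD('n)" by simp
  show ?case
  proof
    fix x
    have "h (dbl UNIV x) = (\<Prod>j\<in>UNIV. a j) *\<^sub>R h x"
      by (rule eigenfunction_dbl) (use empty in auto)
    then show "h x = 0"
      using empty.prems(6)[of x] ne unfolding dbl_UNIV by (metis scaleR_cancel_right)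
  qed
next
  case (insert j S)
  \<comment> \<open>An eigenfunction of doubling in \<open>j\<close> moves \<open>j\<close> to the
    diagonalised coordinates, with eigenvalue \<open>c\<close>; since \<open>k\<close> differs from
    \<open>j\<close>, the update \<open>a(j := c)\<close> keeps the small entry at
    \<open>k\<close>.\<close>
  have step: "g = (\<lambda>x. 0)"
    if g: "dbl_diff c j g = (\<lambda>x. 0)" "0 \<le> c" "c \<le> 8"
      and quart: "\<And>j. j \<in> S \<Longrightarrow> dbl_quartic j g = (\<lambda>x. 0)"
      and eig: "\<And>i. i \<notin> insert j S \<Longrightarrow> dbl_diff (a i) i g = (\<lambda>x. 0)"
      and hom: "\<And>x. g (2 *\<^sub>R x) = (8 ^ CARD('n)) *\<^sub>R g x" for g :: "'a ^ 'n \<Rightarrow> 'b" and c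
    by (rule insert.IH[of g "a(j := c)"]) (use that insert.prems in auto)
  note preserve = dbl_quartic_eq_zero dbl_diff_eq_zero dbl_diff_homogeneous
  note quart = insert.prems(1) and eig = insert.prems(2) and hom = insert.prems(6)
  \<comment> \<open>The factors of the quartic are now peeled off one at a time: what the remaining
    factors make of \<open>h\<close> is an eigenfunction for the removed root, hence zero by
    \<open>step\<close>.\<close>
  have 8: "dbl_diff 1 j (dbl_diff 2 j (dbl_diff 4 j h)) = (\<lambda>x. 0)"
  proof (rule step[where c = 8])
    show "dbl_diff 8 j (dbl_diff 1 j (dbl_diff 2 j (dbl_diff 4 j h))) = (\<lambda>x. 0)"
      using quart[of j] by (simp add: dbl_quartic_def dbl_diff_commute[of 8 j])
  qed (use quart eig hom in \<open>auto intro!: preserve\<close>)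
  have 4: "dbl_diff 1 j (dbl_diff 2 j h) = (\<lambda>x. 0)"
  proof (rule step[where c = 4])
    show "dbl_diff 4 j (dbl_diff 1 j (dbl_diff 2 j h)) = (\<lambda>x. 0)"
      using 8 by (simp add: dbl_diff_commute[of 4 j])
  qed (use quart eig hom in \<open>auto intro!: preserve\<close>)
  have 2: "dbl_diff 1 j h = (\<lambda>x. 0)"
  proof (rule step[where c = 2])
    show "dbl_diff 2 j (dbl_diff 1 j h) = (\<lambda>x. 0)"
      using 4 by (simp add: dbl_diff_commute[of 2 j])
  qed (use quart eig hom in \<open>auto intro!: preserve\<close>)
  show ?case
    by (rule step[where c = 1]) (use 2 quart eig hom in auto)
qed

text \<open>The same peeling at \<open>k\<close> alone removes the factors with roots 4, 2 and 1,
  each root being small enough for \<open>dbl_eigenfunction_zero\<close>; only the factor with root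
  8 survives.\<close>

lemma dbl_eq_8:
  fixes f :: "'a::real_vector ^ 'n::finite \<Rightarrow> 'b::real_vector"
  assumes quart: "\<And>j. dbl_quartic j f = (\<lambda>x. 0)"
    and hom: "\<And>x. f (2 *\<^sub>R x) = (8 ^ CARD('n)) *\<^sub>R f x"
  shows "f (dbl {k} x) = 8 *\<^sub>R f x"
proof -
  have step: "g = (\<lambda>x. 0)"
    if "dbl_diff c k g = (\<lambda>x. 0)" "0 \<le> c" "c \<le> 4"
      "\<And>j. dbl_quartic j g = (\<lambda>x. 0)"
      "\<And>x. g (2 *\<^sub>R x) = (8 ^ CARD('n)) *\<^sub>R g x" for g :: "'a ^ 'n \<Rightarrow> 'b" and c
    by (rule dbl_eigenfunction_zero[where S = "UNIV - {k}" and a = "\<lambda>_. c" and k = k])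
      (use that in auto)
  note preserve = dbl_quartic_eq_zero dbl_diff_homogeneous
  have 4: "dbl_diff 1 k (dbl_diff 2 k (dbl_diff 8 k f)) = (\<lambda>x. 0)"
  proof (rule step[where c = 4])
    show "dbl_diff 4 k (dbl_diff 1 k (dbl_diff 2 k (dbl_diff 8 k f))) = (\<lambda>x. 0)"
      using quart[of k] by (simp add: dbl_quartic_def dbl_diff_commute[of 4 k])
  qed (use quart hom in \<open>auto intro!: preserve\<close>)
  have 2: "dbl_diff 1 k (dbl_diff 8 k f) = (\<lambda>x. 0)"
  proof (rule step[where c = 2])
    show "dbl_diff 2 k (dbl_diff 1 k (dbl_diff 8 k f)) = (\<lambda>x. 0)"
      using 4 by (simp add: dbl_diff_commute[of 2 k])
  qed (use quart hom in \<open>auto intro!: preserve\<close>)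
  have "dbl_diff 8 k f = (\<lambda>x. 0)"
    by (rule step[where c = 1]) (use 2 quart hom in \<open>auto intro!: preserve\<close>)
  then show ?thesis
    by (auto simp: dbl_diff_def fun_eq_iff)
qed

section \<open>Vanishing fourth differences\<close>

text \<open>Such a sequence is a cubic polynomial in its index. The coefficients are those of (X -
  1)(X - 2)(X - 4)(X - 8), which vanishes at X = \<open>2 ^ d\<close> for d = 0, ..., 3, so every
  monomial of degree at most 3 is annihilated.\<close>

lemma fourth_difference_zero_doubling:
  fixes s :: "nat \<Rightarrow> 'a::real_vector"
  assumes "\<And>k. s (k + 4) = 4 *\<^sub>R s (k + 3) - 6 *\<^sub>R s (k + 2) + 4 *\<^sub>R s (k + 1) - s k"
  shows "s 16 - 15 *\<^sub>R s 8 + 70 *\<^sub>R s 4 - 120 *\<^sub>R s 2 + 64 *\<^sub>R s 1 = 0"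
proof -
  \<comment> \<open>the Lagrange interpolation polynomials at the nodes 0, 1, 2, 3\<close>
  define L where "L = (\<lambda>x :: real. (1 - x) * (2 - x) * (3 - x) / 6)"
  define M where "M = (\<lambda>x :: real. x * (2 - x) * (3 - x) / 2)"
  define N where "N = (\<lambda>x :: real. x * (x - 1) * (3 - x) / 2)"
  define P where "P = (\<lambda>x :: real. x * (x - 1) * (x - 2) / 6)"
  have rec: "F (x + 4) = 4 * F (x + 3) - 6 * F (x + 2) + 4 * F (x + 1) - F x"
    if "F \<in> {L, M, N, P}" for F and x :: real
    using that by (auto simp: L_def M_def N_def P_def field_simps)
  have interpolation: "s k = L k *\<^sub>R s 0 + M k *\<^sub>R s 1 + N k *\<^sub>R s 2 + P k *\<^sub>R s 3" for k
  proof (induction k rule: less_induct)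
    case (less k)
    show ?case
    proof (cases "k < 4")
      case True
      then have "k \<in> {0, 1, 2, 3}" by auto
      then show ?thesis by (auto simp: L_def M_def N_def P_def)
    next
      case False
      then obtain m where k: "k = m + 4" by (metis add.commute le_Suc_ex not_less)
      have "m + 3 < k" "m + 2 < k" "m + 1 < k" "m < k"
        using k by simp_all
      note IH = this[THEN less]
      show ?thesis
        unfolding k assms IH by (simp add: rec algebra_simps)
    qed
  qed
  \<comment> \<open>The indices 1 and 2 are nodes themselves, so only \<open>s 16\<close>,
    \<open>s 8\<close> and \<open>s 4\<close> are expanded.\<close>
  have "s 16 - 15 *\<^sub>R s 8 + 70 *\<^sub>R s 4 - 120 *\<^sub>R s 2 + 64 *\<^sub>R s 1
      = (L 16 - 15 * L 8 + 70 * L 4) *\<^sub>R s 0 + (M 16 - 15 * M 8 + 70 * M 4 + 64) *\<^sub>R s 1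
      + (N 16 - 15 * N 8 + 70 * N 4 - 120) *\<^sub>R s 2 + (P 16 - 15 * P 8 + 70 * P 4) *\<^sub>R s 3"
    unfolding interpolation[of 16] interpolation[of 8] interpolation[of 4]
    by (simp add: algebra_simps)
  also have "\<dots> = 0"
    by (simp add: L_def M_def N_def P_def)
  finally show ?thesis .
qed

text \<open>The assumption says that the fourth central difference with step \<open>y\<close> in
  coordinate \<open>j\<close> vanishes. Choosing the step \<open>x $ j\<close> itself places the
  iterated doublings of \<open>x\<close> on one arithmetic progression.\<close>

lemma dbl_diff_quartic:
  fixes f :: "'a::real_vector ^ 'n \<Rightarrow> 'b::real_vector"
  assumes "\<And>x y. f (x + axis j (2 *\<^sub>R y)) + f (x - axis j (2 *\<^sub>R y)) + 6 *\<^sub>R f x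
      = 4 *\<^sub>R (f (x + axis j y) + f (x - axis j y))"
  shows "dbl_quartic j f = (\<lambda>x. 0)"
proof
  fix x :: "'a ^ 'n"
  \<comment> \<open>The offset \<open>real k - 1\<close> makes the \<open>j\<close>th entry of
    \<open>z k\<close> equal to k times \<open>x $ j\<close>, so doubling that entry is doubling the
    index.\<close>
  define z where "z k = x + axis j ((real k - 1) *\<^sub>R x $ j)" for k :: nat
  define s where "s k = f (z k)" for k
  have "s (k + 4) = 4 *\<^sub>R s (k + 3) - 6 *\<^sub>R s (k + 2) + 4 *\<^sub>R s (k + 1) - s k" for k
  proof -
    have three: "3 *\<^sub>R v = v + 2 *\<^sub>R v" for v :: 'a
      using scaleR_add_left[of 1 2 v] by simp
    have shift: "z (k + 2) + axis j (2 *\<^sub>R x $ j) = z (k + 4)"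
      "z (k + 2) - axis j (2 *\<^sub>R x $ j) = z k"
      "z (k + 2) + axis j (x $ j) = z (k + 3)"
      "z (k + 2) - axis j (x $ j) = z (k + 1)"
      by (simp_all add: z_def vec_eq_iff axis_def algebra_simps three flip: scaleR_2)
    have "s (k + 4) + s k + 6 *\<^sub>R s (k + 2) = 4 *\<^sub>R (s (k + 3) + s (k + 1))"
      using assms[of "z (k + 2)" "x $ j"] unfolding shift s_def .
    then show ?thesis by (simp add: algebra_simps)
  qed
  then have "s 16 - 15 *\<^sub>R s 8 + 70 *\<^sub>R s 4 - 120 *\<^sub>R s 2 + 64 *\<^sub>R s 1 = 0"
    by (rule fourth_difference_zero_doubling)
  moreover have z1: "z 1 = x"
    by (simp add: z_def vec_eq_iff axis_def)
  have double: "z (2 * k) = dbl {j} (z k)" for k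
    by (simp add: z_def dbl_def vec_eq_iff axis_def algebra_simps scaleR_2)
  moreover have "z 2 = dbl {j} (z 1)" "z 4 = dbl {j} (z 2)" "z 8 = dbl {j} (z 4)"
    "z 16 = dbl {j} (z 8)"
    using double[of 1] double[of 2] double[of 4] double[of 8] by simp_all
  ultimately show "dbl_quartic j f x = 0"
    using z1 by (simp add: s_def dbl_quartic_def dbl_diff_4)
qed

section \<open>The operator on increments in one coordinate\<close>

text \<open>Grouping by the value b of \<open>s $ j\<close>, the weights on each fibre sum to a
  product of sums: \<open>w b\<close> from coordinate \<open>j\<close> and \<open>sum w B\<close>
  from each of the others.\<close>

lemma sum_vec_entries_weighted:
  fixes w :: "real \<Rightarrow> real" and g :: "real \<Rightarrow> 'b::real_vector" and j :: "'n::finite"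
  assumes "finite B"
  shows "(\<Sum>s | \<forall>i. s $ i \<in> B. (\<Prod>i\<in>UNIV. w (s $ i)) *\<^sub>R g (s $ j))
    = (sum w B) ^ (CARD('n) - 1) *\<^sub>R (\<Sum>b\<in>B. w b *\<^sub>R g b)"
proof -
  let ?A = "{s :: real ^ 'n. \<forall>i. s $ i \<in> B}"
  have fibre: "(\<Sum>s | s \<in> ?A \<and> s $ j = b. \<Prod>i\<in>UNIV. w (s $ i)) = sum w B ^ (CARD('n) - 1) * w b"
    if "b \<in> B" for b
  proof -
    let ?C = "\<lambda>i. if i = j then {b} else B"
    have "(\<Sum>s | s \<in> ?A \<and> s $ j = b. \<Prod>i\<in>UNIV. w (s $ i))
        = (\<Sum>s\<in>PiE UNIV ?C. \<Prod>i\<in>UNIV. w (s i))"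
      using that
      by (intro sum.reindex_bij_witness[where i = vec_lambda and j = vec_nth])
        (auto simp: PiE_iff split: if_splits)
    also have "\<dots> = (\<Prod>i\<in>UNIV. sum w (?C i))"
      using assms by (subst prod_sum_PiE) auto
    also have "\<dots> = w b * (\<Prod>i\<in>UNIV - {j}. sum w B)"
      by (subst prod.remove[of _ j]) auto
    finally show ?thesis by (simp add: card_Diff_singleton)
  qed
  have "(\<Sum>s\<in>?A. (\<Prod>i\<in>UNIV. w (s $ i)) *\<^sub>R g (s $ j))
      = (\<Sum>b\<in>B. \<Sum>s | s \<in> ?A \<and> s $ j = b. (\<Prod>i\<in>UNIV. w (s $ i)) *\<^sub>R g (s $ j))"
    using assms by (intro sum.group[symmetric] finite_vec_entries) auto
  also have "\<dots> = (\<Sum>b\<in>B. (\<Sum>s | s \<in> ?A \<and> s $ j = b. \<Prod>i\<in>UNIV. w (s $ i)) *\<^sub>R g b)"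
    by (intro sum.cong refl) (simp add: scaleR_sum_left)
  also have "\<dots> = (\<Sum>b\<in>B. (sum w B ^ (CARD('n) - 1) * w b) *\<^sub>R g b)"
    by (intro sum.cong refl) (simp only: fibre)
  finally show ?thesis by (simp add: scaleR_sum_right)
qed

text \<open>The coefficient depends only on the number of zero entries and splits into one weight
  per coordinate, 12 for a zero and 2 for a sign. This product form is what
  \<open>sum_vec_entries_weighted\<close> takes.\<close>

lemma M_sum_weighted:
  fixes f :: "'a::real_vector ^ 'n::finite \<Rightarrow> 'b::real_vector"
  shows "(\<Sum>k=0..CARD('n). (2 ^ (CARD('n) - k) * 12 ^ k) *\<^sub>R M_sum f k x y)
    = (\<Sum>s | \<forall>i. s $ i \<in> {-1, 0, 1}.
        (\<Prod>i\<in>UNIV. if s $ i = 0 then 12 else 2) *\<^sub>R f (x + sign_scale s y))"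
proof -
  let ?A = "{s :: real ^ 'n. \<forall>i. s $ i \<in> {-1, 0, 1}}"
  let ?w = "\<lambda>s :: real ^ 'n. \<Prod>i\<in>UNIV. if s $ i = 0 then 12 else 2 :: real"
  let ?z = "\<lambda>s :: real ^ 'n. card {i. s $ i = 0}"
  have w: "?w s = 2 ^ (CARD('n) - ?z s) * 12 ^ ?z s" for s
  proof -
    have "card (- {i. s $ i = 0}) = CARD('n) - ?z s"
      by (simp add: Compl_eq_Diff_UNIV card_Diff_subset)
    then show ?thesis
      by (simp add: prod.If_cases)
  qed
  have "(\<Sum>s\<in>?A. ?w s *\<^sub>R f (x + sign_scale s y))
      = (\<Sum>k=0..CARD('n). \<Sum>s | s \<in> ?A \<and> ?z s = k. ?w s *\<^sub>R f (x + sign_scale s y))"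
    by (intro sum.group[symmetric] finite_vec_entries) (auto intro!: card_mono)
  also have "\<dots> = (\<Sum>k=0..CARD('n). (2 ^ (CARD('n) - k) * 12 ^ k) *\<^sub>R M_sum f k x y)"
    unfolding M_sum_def zero_signs_def scaleR_sum_right w
    by (intro sum.cong) auto
  finally show ?thesis by simp
qed

text \<open>Only the \<open>j\<close>th sign affects the arguments; every other coordinate
  contributes its total weight, 1 + 1 = 2 in the first sum and 2 + 12 + 2 = 16 in the
  second.\<close>

lemma D_op_axis:
  fixes f :: "'a::real_vector ^ 'n::finite \<Rightarrow> 'b::real_vector"
  shows "D_op f x (axis j y)
    = 2 ^ (CARD('n) - 1) *\<^sub>R (f (2 *\<^sub>R x + axis j y) + f (2 *\<^sub>R x - axis j y))
      - 16 ^ (CARD('n) - 1) *\<^sub>R (2 *\<^sub>R f (x + axis j y) + 2 *\<^sub>R f (x - axis j y) + 12 *\<^sub>R f x)"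
proof -
  have ss: "sign_scale s (axis j y) = s $ j *\<^sub>R axis j y" for s
    by (simp add: sign_scale_def axis_def vec_eq_iff)
  have "(\<Sum>q\<in>full_signs. f (2 *\<^sub>R x + sign_scale q (axis j y)))
      = (\<Sum>s | \<forall>i::'n. s $ i \<in> {-1, 1}. (\<Prod>i\<in>(UNIV::'n set). 1) *\<^sub>R f (2 *\<^sub>R x + s $ j *\<^sub>R axis j y))"
    by (simp add: full_signs_def ss)
  also have "\<dots> = 2 ^ (CARD('n) - 1) *\<^sub>R (f (2 *\<^sub>R x + axis j y) + f (2 *\<^sub>R x - axis j y))"
    by (subst sum_vec_entries_weighted) (simp_all add: algebra_simps)
  finally have 1: "(\<Sum>q\<in>full_signs. f (2 *\<^sub>R x + sign_scale q (axis j y)))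
      = 2 ^ (CARD('n) - 1) *\<^sub>R (f (2 *\<^sub>R x + axis j y) + f (2 *\<^sub>R x - axis j y))" .
  have 2: "(\<Sum>k=0..CARD('n). (2 ^ (CARD('n) - k) * 12 ^ k) *\<^sub>R M_sum f k x (axis j y))
      = 16 ^ (CARD('n) - 1) *\<^sub>R (2 *\<^sub>R f (x + axis j y) + 2 *\<^sub>R f (x - axis j y) + 12 *\<^sub>R f x)"
    unfolding M_sum_weighted ss
    by (subst sum_vec_entries_weighted) (simp_all add: algebra_simps)
  show ?thesis unfolding D_op_def 1 2 ..
qed

section \<open>Scaling under doubling\<close>

lemma D_op_homogeneous:
  assumes "\<And>x. f (2 *\<^sub>R x) = c *\<^sub>R f x"
  shows "D_op f (2 *\<^sub>R x) (2 *\<^sub>R y) = c *\<^sub>R D_op f x y"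
proof -
  have ss: "sign_scale s (2 *\<^sub>R y) = 2 *\<^sub>R sign_scale s y" for s
    by (simp add: sign_scale_def vec_eq_iff)
  show ?thesis
    unfolding D_op_def M_sum_def ss scaleR_add_right[symmetric] assms
    by (simp add: scaleR_sum_right scaleR_diff_right mult.commute)
qed

text \<open>Comparing the two sides at \<open>2 ^ m\<close> times \<open>x\<close> if b < a, or at
  \<open>x\<close> divided by \<open>2 ^ m\<close> if a < b, gains a factor \<open>q ^ m\<close>
  with q < 1, which tends to 0.\<close>

lemma double_homogeneous_bound_zero:
  fixes d B :: "'a::real_vector \<Rightarrow> real"
  assumes d: "\<And>x. d (2 *\<^sub>R x) = a * d x" and B: "\<And>x. B (2 *\<^sub>R x) = b * B x"
    and bound: "\<And>x. \<bar>d x\<bar> \<le> B x"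
    and "0 < a" "0 < b" "a \<noteq> b"
  shows "d x = 0"
proof -
  have zero: "t = 0" if "\<bar>q\<bar> < 1" "\<And>m::nat. \<bar>t\<bar> \<le> q ^ m * c" for q t c :: real
  proof -
    have "(\<lambda>m. q ^ m * c) \<longlonglongrightarrow> 0"
      using LIMSEQ_power_zero[of q] that(1) by (intro tendsto_mult_left_zero) simp
    then have "\<bar>t\<bar> \<le> 0"
      by (rule LIMSEQ_le_const) (use that(2) in blast)
    then show ?thesis by simp
  qed
  show ?thesis
  proof (cases "b < a")
    case True
    have "\<bar>d x\<bar> \<le> (b / a) ^ m * B x" for m
    proof (induction m arbitrary: x)
      case (Suc m)
      have "a * \<bar>d x\<bar> \<le> (b / a) ^ m * (b * B x)"
        using Suc[of "2 *\<^sub>R x"] \<open>0 < a\<close> by (simp add: d B abs_mult)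
      then show ?case using \<open>0 < a\<close> by (simp add: field_simps)
    qed (use bound in simp)
    then show ?thesis
      by (rule zero[rotated]) (use True assms in simp)
  next
    case False
    have "\<bar>d x\<bar> \<le> (a / b) ^ m * B x" for m
    proof (induction m arbitrary: x)
      case (Suc m)
      have "d x = a * d ((1 / 2) *\<^sub>R x)" "B x = b * B ((1 / 2) *\<^sub>R x)"
        using d[of "(1 / 2) *\<^sub>R x"] B[of "(1 / 2) *\<^sub>R x"] by simp_all
      then show ?case
        using mult_left_mono[OF Suc[of "(1 / 2) *\<^sub>R x"], of a] \<open>0 < a\<close> \<open>0 < b\<close>
        by (simp add: abs_mult mult.assoc)
    qed (use bound in simp)
    then show ?thesis
      by (rule zero[rotated]) (use False assms in simp)
  qed
qed

section \<open>Hyperstability\<close>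

lemma D_op_zero_imp_multi_cubic:
  fixes f :: "'a::real_vector ^ 'n::finite \<Rightarrow> 'b::real_vector"
  assumes D: "\<And>x y. D_op f x y = 0" and hom: "\<And>x. f (2 *\<^sub>R x) = (8 ^ CARD('n)) *\<^sub>R f x"
  shows "multi_cubic f"
proof -
  obtain m where m: "CARD('n) = Suc m"
    using gr0_conv_Suc[of "CARD('n)"] by auto
  \<comment> \<open>With increment 2y the arguments 2x + 2y and 2x - 2y are doubled points, so
    \<open>hom\<close> applies to them. As \<open>2 ^ m * 8 ^ (m + 1) = 8 * 16 ^ m\<close>, the
    powers of 16 cancel and a vanishing fourth difference remains.\<close>
  have sec: "f (x + axis j (2 *\<^sub>R y)) + f (x - axis j (2 *\<^sub>R y)) + 6 *\<^sub>R f x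
      = 4 *\<^sub>R (f (x + axis j y) + f (x - axis j y))" for x y j
  proof -
    have e: "2 *\<^sub>R x + axis j (2 *\<^sub>R y) = 2 *\<^sub>R (x + axis j y)"
      "2 *\<^sub>R x - axis j (2 *\<^sub>R y) = 2 *\<^sub>R (x - axis j y)"
      by (simp_all add: vec_eq_iff axis_def algebra_simps)
    let ?l = "f (x + axis j y) + f (x - axis j y)"
    let ?r = "f (x + axis j (2 *\<^sub>R y)) + f (x - axis j (2 *\<^sub>R y)) + 6 *\<^sub>R f x"
    have "2 ^ m *\<^sub>R ((8 * 8 ^ m) *\<^sub>R ?l) = 16 ^ m *\<^sub>R (2 *\<^sub>R ?r)"
      using D_op_axis[of f x j "2 *\<^sub>R y"]
      unfolding D e hom m by (simp add: algebra_simps)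
    moreover have "(2::real) ^ m * (8 * 8 ^ m) = 16 ^ m * 8"
      by (simp flip: power_mult_distrib)
    ultimately have "(16::real) ^ m *\<^sub>R (8 *\<^sub>R ?l) = 16 ^ m *\<^sub>R (2 *\<^sub>R ?r)"
      by (simp only: scaleR_scaleR)
    then have "8 *\<^sub>R ?l = 2 *\<^sub>R ?r" by (simp del: scaleR_scaleR)
    then have "(1 / 2 :: real) *\<^sub>R (8 *\<^sub>R ?l) = (1 / 2 :: real) *\<^sub>R (2 *\<^sub>R ?r)" by (simp only:)
    then show ?thesis by simp
  qed
  have eight: "f (dbl {j} x) = 8 *\<^sub>R f x" for j x
    by (rule dbl_eq_8[of f, OF dbl_diff_quartic[of f, OF sec] hom])
  show ?thesis
    unfolding multi_cubic_def cubic_def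
  proof (intro allI)
    fix j and x :: "'a ^ 'n" and u v :: 'a
    let ?g = "\<lambda>v. f (\<chi> i. if i = j then v else x $ i)"
    let ?z = "\<chi> i. if i = j then u else x $ i"
    have g8: "?g (2 *\<^sub>R w) = 8 *\<^sub>R ?g w" for w
      unfolding eight[of j, symmetric]
      by (rule arg_cong[of _ _ f]) (simp add: vec_eq_iff dbl_def)
    have "?z + axis j w = (\<chi> i. if i = j then u + w else x $ i)"
      "?z - axis j w = (\<chi> i. if i = j then u - w else x $ i)" for w
      by (simp_all add: vec_eq_iff axis_def)
    \<comment> \<open>The half increment is chosen because \<open>g8\<close> turns 8 times the value
      at u + v/2 or u - v/2 into the value at 2u + v or 2u - v.\<close>
    with sec[of ?z j "(1 / 2) *\<^sub>R v"]
    have "?g (u + v) + ?g (u - v) + 6 *\<^sub>R ?g u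
        = 4 *\<^sub>R (?g (u + (1 / 2) *\<^sub>R v) + ?g (u - (1 / 2) *\<^sub>R v))"
      by simp
    then have "2 *\<^sub>R (?g (u + v) + ?g (u - v) + 6 *\<^sub>R ?g u)
        = 8 *\<^sub>R ?g (u + (1 / 2) *\<^sub>R v) + 8 *\<^sub>R ?g (u - (1 / 2) *\<^sub>R v)"
      by (simp add: scaleR_add_right)
    also have "\<dots> = ?g (2 *\<^sub>R u + v) + ?g (2 *\<^sub>R u - v)"
      unfolding g8[symmetric] by (simp add: scaleR_add_right scaleR_diff_right cong: if_cong)
    finally show "?g (2 *\<^sub>R u + v) + ?g (2 *\<^sub>R u - v)
        = 2 *\<^sub>R ?g (u + v) + 2 *\<^sub>R ?g (u - v) + 12 *\<^sub>R ?g u"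
      by (simp add: scaleR_add_right)
  qed
qed

theorem corollary3p4:
  fixes \<delta> :: real
    and p :: "nat \<Rightarrow> 'n::finite \<Rightarrow> real"
    and f :: "'v::real_normed_vector ^ 'n \<Rightarrow> 'w::banach"
  assumes "\<delta> > 0"
    and "\<And>i j. i \<in> {1, 2} \<Longrightarrow> p i j > 0"
    and "(\<Sum>i=1..2. \<Sum>j\<in>UNIV. p i j) \<noteq> 3 * real CARD('n)"
    and "\<And>x :: nat \<Rightarrow> 'v ^ 'n.
           norm (D_op f (x 1) (x 2)) \<le> \<delta> * (\<Prod>i=1..2. \<Prod>j\<in>UNIV. norm (x i $ j) powr p i j)"
  shows "multi_cubic f"
proof -
  define S where "S = (\<Sum>i=1..2. \<Sum>j\<in>UNIV. p i j)"
  \<comment> \<open>Pairing both arguments makes their simultaneous doubling a single scaling by 2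
    in the product space.\<close>
  define B where "B z = \<delta> * ((\<Prod>j\<in>UNIV. norm (fst z $ j) powr p 1 j)
    * (\<Prod>j\<in>UNIV. norm (snd z $ j) powr p 2 j))" for z :: "('v ^ 'n) \<times> ('v ^ 'n)"
  have two: "{1..2::nat} = {1, 2}" by auto
  have bound: "norm (D_op f (fst z) (snd z)) \<le> B z" for z
    using assms(4)[of "\<lambda>i. if i = 1 then fst z else snd z"] unfolding two by (simp add: B_def)
  have hom: "f (2 *\<^sub>R x) = (8 ^ CARD('n)) *\<^sub>R f x" for x
  proof -
    obtain m where m: "CARD('n) = Suc m"
      using gr0_conv_Suc[of "CARD('n)"] by auto
    obtain j :: 'n where True by simp
    have axis_0: "axis j (0 :: 'v) = 0"
      by simp
    \<comment> \<open>The zero vector is written as \<open>axis j 0\<close> so that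
      \<open>D_op_axis\<close> applies; the bound is 0 there because \<open>0 powr p 2 j\<close> is
      0.\<close>
    have "D_op f x (axis j 0) = 0"
      using bound[of "(x, axis j 0)"] by (simp add: B_def axis_0 power_0_left)
    then have "2 ^ m *\<^sub>R (f (2 *\<^sub>R x) + f (2 *\<^sub>R x)) = 16 ^ m *\<^sub>R (16 *\<^sub>R f x)"
      unfolding D_op_axis m by (simp add: axis_0 flip: scaleR_add_left scaleR_scaleR)
    then have "(2 ^ m * 2) *\<^sub>R f (2 *\<^sub>R x) = (16 ^ m * 16) *\<^sub>R f x"
      by (simp only: scaleR_2 flip: scaleR_scaleR)
    moreover have "(16 ^ m * 16 :: real) = (2 ^ m * 2) * 8 ^ CARD('n)"
      by (simp add: m flip: power_mult_distrib)
    ultimately show ?thesis by (simp flip: scaleR_scaleR)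
  qed
  have "D_op f x y = 0" for x y
  proof -
    have "norm (D_op f (fst z) (snd z)) = 0" for z
    proof (rule double_homogeneous_bound_zero[where B = B and a = "8 ^ CARD('n)" and b = "2 powr S"])
      show "norm (D_op f (fst (2 *\<^sub>R z)) (snd (2 *\<^sub>R z)))
          = 8 ^ CARD('n) * norm (D_op f (fst z) (snd z))" for z
        by (simp add: D_op_homogeneous[of f, OF hom])
      show "B (2 *\<^sub>R z) = 2 powr S * B z" for z
        unfolding B_def S_def two by (simp add: powr_mult prod.distrib powr_add powr_sum)
      \<comment> \<open>Both scaling factors become powers of 2, with exponents 3n and
        \<open>S\<close>, which differ by the hypothesis on the sum of the
        \<open>p i j\<close>.\<close>
      have "(8::real) ^ CARD('n) = 2 powr (3 * real CARD('n))"
        by (simp add: powr_powr[symmetric] powr_realpow)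
      then show "8 ^ CARD('n) \<noteq> 2 powr S"
        using assms(3) by (auto simp: S_def powr_inj)
    qed (use bound in simp_all)
    from this[of "(x, y)"] show ?thesis by simp
  qed
  with hom show ?thesis by (intro D_op_zero_imp_multi_cubic)
qed

end
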